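(* Let $t$ be an odd positive integer and $n$ a positive integer, and let $$\theta_t(n) = \sqrt{\frac{2n}{t} + \frac14} + \frac12, \qquad \psi_t(n) = \sqrt{2nt + \left(\frac{t-2}{2}\right)^2} - \frac{t-2}{2}.$$ Then the number of representations of $n$ as a positive trapezoid with difference $t$ is $$\Phi_t^+(n) = d_1(n) + d_1(n,\theta_t(n)) - d_1(n,\psi_t(n)).$$
   Context: For $k \in \mathbb{N}$, $t \in \mathbb{N}_0$, $a \in \mathbb{Z}$, let $s_{k,t}(a) = \sum_{i=0}^{k-1}(a+it) = ka + \frac{k(k-1)t}{2}$. Define $\Phi_t^+(n) = |\{(k,a) \in \mathbb{N}\times\mathbb{N} : s_{k,t}(a) = n\}|$, the number of representations of $n$ as a sum of a finite arithmetic progression with difference $t$ all of whose terms are positive integers. $d_1(n)$ is the number of odd positive divisors of $n$, and for a real number $x$, $d_1(n,x)$ is the number of odd positive divisors $d$ of $n$ with $d < x$. *)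

theory Defs
  imports Complex_Main
begin

definition trapezoid_sum :: "nat \<Rightarrow> nat \<Rightarrow> int \<Rightarrow> int" where
  "trapezoid_sum k t a = (\<Sum>i = 0..<k. a + int i * int t)"

(* For n > 0 the set is finite, so card is the true number of representations. *)
definition Phi_pos :: "nat \<Rightarrow> nat \<Rightarrow> nat" where
  "Phi_pos t n = card {(k :: nat, a :: nat). k > 0 \<and> a > 0 \<and> trapezoid_sum k t (int a) = int n}"

definition d1 :: "nat \<Rightarrow> nat" where
  "d1 n = card {d :: nat. d > 0 \<and> odd d \<and> d dvd n}"

definition d1_below :: "nat \<Rightarrow> real \<Rightarrow> nat" where
  "d1_below n x = card {d :: nat. d > 0 \<and> odd d \<and> d dvd n \<and> real d < x}"

definition theta :: "nat \<Rightarrow> nat \<Rightarrow> real" where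
  "theta t n = sqrt (2 * real n / real t + 1 / 4) + 1 / 2"

definition psi :: "nat \<Rightarrow> nat \<Rightarrow> real" where
  "psi t n = sqrt (2 * real n * real t + ((real t - 2) / 2)\<^sup>2) - (real t - 2) / 2"

end

theory Submission
  imports Defs
begin

text \<open>
  Doubling the sum gives \<open>2 n = k m\<close> with \<open>m = 2 a + (k - 1) t\<close>. As \<open>t\<close> is odd, exactly one
  of the factors \<open>k\<close>, \<open>m\<close> is odd, and that factor is an odd divisor \<open>d\<close> of \<open>n\<close> which determines
  the representation. If \<open>k = d\<close>, positivity of \<open>a\<close> reads \<open>d < \<theta>\<close>. If \<open>m = d\<close>, positivity means
  \<open>2 \<le> 2 a = d - (2 n / d - 1) t\<close>, which reads \<open>d \<ge> \<psi>\<close>.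
\<close>

lemma double_trapezoid_sum:
  "2 * trapezoid_sum k t a = int k * (2 * a + (int k - 1) * int t)"
  by (induction k) (simp_all add: trapezoid_sum_def algebra_simps)

text \<open>An odd number \<open>2 * j + 1\<close> of terms has the middle term
  \<open>a + j * t\<close>, which is also their mean.\<close>

lemma trapezoid_sum_odd_iff:
  "trapezoid_sum (2 * j + 1) t (int a) = int n \<longleftrightarrow> n = (2 * j + 1) * (a + j * t)"
proof -
  have "2 * trapezoid_sum (2 * j + 1) t (int a) = 2 * int ((2 * j + 1) * (a + j * t))"
    unfolding double_trapezoid_sum by (simp add: algebra_simps)
  then have "trapezoid_sum (2 * j + 1) t (int a) = int ((2 * j + 1) * (a + j * t))" by linarith
  then show ?thesis by (metis of_nat_eq_iff)
qed

text \<open>The terms form \<open>q\<close> pairs, symmetric about the centre, each with sum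
  \<open>m\<close>, the first term plus the last. The additive hypothesis avoids truncated
  subtraction.\<close>

lemma trapezoid_sum_even_iff:
  assumes "m + t = 2 * a + 2 * q * t"
  shows "trapezoid_sum (2 * q) t (int a) = int n \<longleftrightarrow> n = q * m"
proof -
  have "int m = 2 * int a + (int (2 * q) - 1) * int t"
    using arg_cong[OF assms, of int] by (simp add: algebra_simps)
  then have "2 * trapezoid_sum (2 * q) t (int a) = 2 * int (q * m)"
    unfolding double_trapezoid_sum by simp
  then have "trapezoid_sum (2 * q) t (int a) = int (q * m)" by linarith
  then show ?thesis by (metis of_nat_eq_iff)
qed

lemma less_sqrt_iff_power2_less:
  fixes x y :: real
  assumes "0 \<le> x"
  shows "x < sqrt y \<longleftrightarrow> x\<^sup>2 < y"
  using assms by (metis real_sqrt_less_iff real_sqrt_abs abs_of_nonneg)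

text \<open>\<open>theta t n\<close> is the larger root of \<open>x * (x - 1) = 2 * n / t\<close>.
  With \<open>2 * j + 1\<close> terms, \<open>q\<close> is the middle one and
  \<open>q - j * t\<close> the first, so the bound expresses positivity of the first term.\<close>

lemma less_theta_iff:
  assumes "t > 0" and "n = (2 * j + 1) * q"
  shows "real (2 * j + 1) < theta t n \<longleftrightarrow> j * t < q"
proof -
  let ?d = "real (2 * j + 1)"
  have "?d < theta t n \<longleftrightarrow> ?d - 1 / 2 < sqrt (2 * real n / real t + 1 / 4)"
    by (auto simp: theta_def)
  also have "\<dots> \<longleftrightarrow> (?d - 1 / 2)\<^sup>2 < 2 * real n / real t + 1 / 4"
    by (rule less_sqrt_iff_power2_less) simp
  \<comment> \<open>Subtracting \<open>1 / 4\<close> leaves \<open>?d * (?d - 1)\<close> on the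
    left, and \<open>?d - 1 = 2 * j\<close>.\<close>
  also have "\<dots> \<longleftrightarrow> ?d * (2 * real j) < ?d * (2 * real q) / real t"
    by (simp add: assms(2) power2_eq_square algebra_simps)
  also have "\<dots> \<longleftrightarrow> ?d * (2 * real j) * real t < ?d * (2 * real q)"
    using assms(1) by (simp only: pos_less_divide_eq of_nat_0_less_iff)
  also have "\<dots> \<longleftrightarrow> (2 * ?d) * real (j * t) < (2 * ?d) * real q"
    by (simp add: ac_simps)
  also have "\<dots> \<longleftrightarrow> real (j * t) < real q"
    by (rule mult_less_cancel_left_pos) simp
  also have "\<dots> \<longleftrightarrow> j * t < q"
    by (rule of_nat_less_iff)
  finally show ?thesis .
qed

text \<open>\<open>psi t n\<close> is the larger root of
  \<open>x\<^sup>2 + (t - 2) * x = 2 * n * t\<close>; for \<open>n = q * d\<close> the factor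
  \<open>d\<close> cancels. If \<open>d + t = 2 * a + 2 * q * t\<close>, the right-hand side becomes
  \<open>a < 1\<close>.\<close>

lemma less_psi_iff:
  assumes "d > 0" and "t > 0" and "n = q * d"
  shows "real d < psi t n \<longleftrightarrow> d + t < 2 * q * t + 2"
proof -
  let ?c = "(real t - 2) / 2"
  have "real d < psi t n \<longleftrightarrow> real d + ?c < sqrt (2 * real n * real t + ?c\<^sup>2)"
    by (auto simp: psi_def)
  also have "\<dots> \<longleftrightarrow> (real d + ?c)\<^sup>2 < 2 * real n * real t + ?c\<^sup>2"
    \<comment> \<open>\<open>?c\<close> is \<open>- 1 / 2\<close> for \<open>t = 1\<close>, but
      \<open>d \<ge> 1\<close> keeps \<open>d + ?c\<close> positive.\<close>
    using assms(1,2) by (intro less_sqrt_iff_power2_less) (simp add: field_simps)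
  also have "\<dots> \<longleftrightarrow> real d * (real d + 2 * ?c) < real d * (2 * real q * real t)"
    unfolding power2_sum by (simp add: assms(3) power2_eq_square algebra_simps)
  also have "\<dots> \<longleftrightarrow> real d + 2 * ?c < 2 * real q * real t"
    using assms(1) by (intro mult_less_cancel_left_pos) simp
  also have "\<dots> \<longleftrightarrow> real (d + t) < real (2 * q * t + 2)"
    unfolding of_nat_add of_nat_mult of_nat_numeral by argo
  also have "\<dots> \<longleftrightarrow> d + t < 2 * q * t + 2"
    by (rule of_nat_less_iff)
  finally show ?thesis .
qed

lemma bij_betw_odd_trapezoids:
  assumes "t > 0"
  shows "bij_betw fst {(k, a). odd k \<and> a > 0 \<and> trapezoid_sum k t (int a) = int n}
    {d. d > 0 \<and> odd d \<and> d dvd n \<and> real d < theta t n}" (is "bij_betw fst ?A ?B")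
proof (rule bij_betw_imageI)
  show "inj_on fst ?A"
  proof (clarsimp simp: inj_on_def)
    fix k a b
    assume "odd k" "trapezoid_sum k t (int a) = int n" "trapezoid_sum k t (int b) = int n"
    moreover from \<open>odd k\<close> obtain j where "k = 2 * j + 1" by (rule oddE)
    ultimately have "(2 * j + 1) * (a + j * t) = (2 * j + 1) * (b + j * t)"
      using trapezoid_sum_odd_iff by metis
    then show "a = b" unfolding mult_cancel1 by simp
  qed
  show "fst ` ?A = ?B"
  proof (intro equalityI subsetI)
    fix d assume "d \<in> fst ` ?A"
    then obtain a where d: "odd d" "a > 0" "trapezoid_sum d t (int a) = int n" by auto
    then obtain j where j: "d = 2 * j + 1" by (auto elim: oddE)
    with d have n: "n = (2 * j + 1) * (a + j * t)" using trapezoid_sum_odd_iff by metis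
    have "d dvd n" unfolding n j by (rule dvd_triv_left)
    moreover have "real d < theta t n"
      using less_theta_iff[OF assms n] d(2) unfolding j by simp
    ultimately show "d \<in> ?B" using d(1) by (auto intro: odd_pos)
  next
    fix d assume "d \<in> ?B"
    then have d: "odd d" "d dvd n" "real d < theta t n" by auto
    obtain j where j: "d = 2 * j + 1" using d(1) by (rule oddE)
    obtain q where q: "n = (2 * j + 1) * q" using d(2) unfolding j by (rule dvdE)
    have "j * t < q" using less_theta_iff[OF assms q] d(3) unfolding j by blast
    \<comment> \<open>The first term lies \<open>j\<close> steps below the middle term
      \<open>q\<close>; since \<open>j * t < q\<close>, the subtraction is exact and
      positive.\<close>
    then have "(d, q - j * t) \<in> ?A"
      using trapezoid_sum_odd_iff[of j t "q - j * t" n] d(1) q unfolding j by simp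
    then show "d \<in> fst ` ?A" by (rule rev_image_eqI) simp
  qed
qed

text \<open>The length \<open>k = 2 * q\<close> is sent to the cofactor \<open>n div q\<close>, the
  sum of the first and last terms. This cofactor determines \<open>q\<close>, and then
  \<open>a\<close>.\<close>

lemma bij_betw_even_trapezoids:
  assumes "odd t" and "n > 0"
  shows "bij_betw (\<lambda>(k, a). 2 * n div k)
    {(k, a). k > 0 \<and> even k \<and> a > 0 \<and> trapezoid_sum k t (int a) = int n}
    {d. d > 0 \<and> odd d \<and> d dvd n \<and> \<not> real d < psi t n}" (is "bij_betw ?f ?A ?B")
proof -
  have t: "t > 0" using assms(1) by (rule odd_pos)
  have split: "\<exists>q m. k = 2 * q \<and> q > 0 \<and> m > 0 \<and> n = q * m \<and> m + t = 2 * a + 2 * q * t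
      \<and> 2 * n div k = m" if "(k, a) \<in> ?A" for k a
  proof -
    from that obtain q where q: "k = 2 * q" "q > 0" by (auto elim: evenE)
    define m where "m = 2 * a + 2 * q * t - t"
    \<comment> \<open>This rules out truncation in the definition of \<open>m\<close>.\<close>
    have "1 * t \<le> 2 * q * t" using q(2) by (intro mult_right_mono) auto
    then have m: "m + t = 2 * a + 2 * q * t" unfolding m_def by linarith
    have n: "n = q * m" using that trapezoid_sum_even_iff[OF m] q by simp
    then have "2 * n div k = m" using q by simp
    then show ?thesis using q m n assms(2) by auto
  qed
  show ?thesis
  proof (rule bij_betw_imageI)
    show "inj_on ?f ?A"
    proof (rule inj_onI)
      fix x y assume x: "x \<in> ?A" and y: "y \<in> ?A" and eq: "?f x = ?f y"
      obtain k a l b where xy: "x = (k, a)" "y = (l, b)" by (cases x, cases y)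
      obtain q m where 1: "k = 2 * q" "m > 0" "n = q * m" "m + t = 2 * a + 2 * q * t"
        "2 * n div k = m" using split x unfolding xy by blast
      obtain r m' where 2: "l = 2 * r" "n = r * m'" "m' + t = 2 * b + 2 * r * t"
        "2 * n div l = m'" using split y unfolding xy by blast
      have "m = m'" using eq 1 2 by (simp add: xy)
      then have "q = r" using 1 2 by simp
      then show "x = y" using 1 2 \<open>m = m'\<close> by (simp add: xy)
    qed
    show "?f ` ?A = ?B"
    proof (intro equalityI subsetI)
      fix d assume "d \<in> ?f ` ?A"
      then obtain k a where ka: "(k, a) \<in> ?A" "d = 2 * n div k" by auto
      obtain q where q: "d > 0" "n = q * d" "d + t = 2 * a + 2 * q * t"
        using split[OF ka(1)] unfolding ka(2) by metis
      \<comment> \<open>Thus \<open>d\<close> has the parity of \<open>t\<close>, which is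
        odd.\<close>
      have "even (d + t)" unfolding q(3) by simp
      then have "odd d" using assms(1) by simp
      have "a > 0" using ka(1) by simp
      then have "\<not> real d < psi t n" using less_psi_iff[OF q(1) t q(2)] q(3) by linarith
      moreover have "d dvd n" unfolding q(2) by (rule dvd_triv_right)
      ultimately show "d \<in> ?B" using q(1) \<open>odd d\<close> by blast
    next
      fix d assume "d \<in> ?B"
      then have d: "d > 0" "odd d" "d dvd n" "\<not> real d < psi t n" by auto
      obtain q where q: "n = q * d" using d(3) by (metis dvdE mult.commute)
      have le: "2 * q * t + 2 \<le> d + t" using less_psi_iff[OF d(1) t q] d(4) by simp
      \<comment> \<open>Solves \<open>d + t = 2 * a + 2 * q * t\<close> for \<open>a\<close>: the
        halving is exact as \<open>d\<close> and \<open>t\<close> are odd, and \<open>le\<close>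
        gives \<open>a \<ge> 1\<close>.\<close>
      define a where "a = (d + t) div 2 - q * t"
      have "2 * ((d + t) div 2) = d + t" using d(2) assms(1) by simp
      then have a: "a > 0" "d + t = 2 * a + 2 * q * t" using le by (auto simp: a_def)
      have "q > 0" using q assms(2) by simp
      moreover have "trapezoid_sum (2 * q) t (int a) = int n"
        using trapezoid_sum_even_iff[OF a(2)] q by blast
      ultimately have "(2 * q, a) \<in> ?A" using a(1) by simp
      then show "d \<in> ?f ` ?A" by (rule rev_image_eqI) (use q \<open>q > 0\<close> in simp)
    qed
  qed
qed

theorem theorem6:
  fixes t n :: nat
  assumes "t > 0" and "odd t" and "n > 0"
  shows "int (Phi_pos t n) = int (d1 n) + int (d1_below n (theta t n)) - int (d1_below n (psi t n))"
proof -
  let ?O = "{(k, a). odd k \<and> a > 0 \<and> trapezoid_sum k t (int a) = int n}"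
  let ?E = "{(k, a). k > 0 \<and> even k \<and> a > 0 \<and> trapezoid_sum k t (int a) = int n}"
  let ?D = "{d. d > 0 \<and> odd d \<and> d dvd n}"
  let ?T = "{d. d > 0 \<and> odd d \<and> d dvd n \<and> real d < theta t n}"
  let ?P = "{d. d > 0 \<and> odd d \<and> d dvd n \<and> real d < psi t n}"
  let ?N = "{d. d > 0 \<and> odd d \<and> d dvd n \<and> \<not> real d < psi t n}"
  have fin: "finite ?D"
    using assms(3) by (intro finite_subset[OF _ finite_atMost[of n]]) (auto dest: dvd_imp_le)
  have finT: "finite ?T" and finP: "finite ?P" and finN: "finite ?N"
    by (rule finite_subset[OF _ fin], blast)+
  have O: "card ?O = card ?T" "finite ?O"
    using bij_betw_odd_trapezoids[OF assms(1)] finT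
    by (blast dest: bij_betw_same_card, blast dest: bij_betw_finite)
  have E: "card ?E = card ?N" "finite ?E"
    using bij_betw_even_trapezoids[OF assms(2,3)] finN
    by (blast dest: bij_betw_same_card, blast dest: bij_betw_finite)
  have "{(k, a). k > 0 \<and> a > 0 \<and> trapezoid_sum k t (int a) = int n} = ?O \<union> ?E"
    by (auto intro: odd_pos)
  moreover have "card (?O \<union> ?E) = card ?O + card ?E"
    using O(2) E(2) by (intro card_Un_disjoint) auto
  ultimately have "Phi_pos t n = card ?T + card ?N"
    by (simp only: Phi_pos_def O(1) E(1))
  \<comment> \<open>This turns \<open>card ?N\<close> into \<open>d1 n\<close> minus the number of
    odd divisors below \<open>psi t n\<close>.\<close>
  moreover have "card ?D = card ?P + card ?N"
    using finP finN by (subst card_Un_disjoint[symmetric]) (auto intro: arg_cong[where f = card])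
  ultimately show ?thesis
    unfolding d1_def d1_below_def by linarith
qed

end
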